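(* Let $k$ be a positive integer and $i\in\{5,7,11\}$. Let $p$ be a prime with $p\equiv i\pmod{12}$, and let $\delta$ be a non-negative integer such that $p$ divides $12\delta+i$. Then for every non-negative integer $n$, \[ \sigma mex\left(p^{k+1}n+p\delta+\frac{pi-1}{12}\right)\equiv f(p)\,\sigma mex\left(p^{k-1}n+\frac{12\delta+i-p}{12p}\right)\pmod 4, \] where $f(p)=-1$ if $p\equiv 5\pmod{12}$ and $f(p)=1$ if $p\equiv 7,11\pmod{12}$.
   Context: For a partition $\pi$ of a positive integer $n$, $mex(\pi)$ is the smallest positive integer that is not a part of $\pi$. For a positive integer $n$, $\sigma mex(n)=\sum_{\pi} mex(\pi)$, summed over all partitions $\pi$ of $n$, and $\sigma mex(0)=1$. Equivalently, $\sum_{n\geq 0}\sigma mex(n)q^n=(-q;q)_\infty^2$, where $(a;q)_\infty=\prod_{m\geq 1}(1-aq^{m-1})$. *)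

theory Defs
  imports "HOL-Library.Multiset" "HOL-Number_Theory.Number_Theory"
begin

definition partitions_of :: "nat \<Rightarrow> nat multiset set" where
  "partitions_of n = {\<pi>. 0 \<notin># \<pi> \<and> sum_mset \<pi> = n}"

definition mex :: "nat multiset \<Rightarrow> nat" where
  "mex \<pi> = (LEAST m. 0 < m \<and> m \<notin># \<pi>)"

definition sigma_mex :: "nat \<Rightarrow> nat" where
  "sigma_mex n = (if n = 0 then 1 else \<Sum>\<pi>\<in>partitions_of n. mex \<pi>)"

text \<open>Only used for primes congruent to 5, 7 or 11 modulo 12.\<close>
definition mex_sign :: "nat \<Rightarrow> int" where
  "mex_sign p = (if [p = 5] (mod 12) then -1 else 1)"

lemma finite_partitions_of: "finite (partitions_of n)"
proof -
  have size: "size \<pi> \<le> sum_mset \<pi>" if "0 \<notin># \<pi>" for \<pi> :: "nat multiset"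
    using that by (induction \<pi>) auto
  have "partitions_of n \<subseteq> mset ` {xs. set xs \<subseteq> {..n} \<and> length xs \<le> n}"
  proof
    fix \<pi> assume \<pi>: "\<pi> \<in> partitions_of n"
    obtain xs where xs: "mset xs = \<pi>" using ex_mset by blast
    have "length xs \<le> n" using size[of \<pi>] \<pi> xs by (auto simp: partitions_of_def)
    moreover have "x \<le> n" if "x \<in># \<pi>" for x
      using \<pi> that by (auto simp: partitions_of_def dest!: multi_member_split)
    ultimately show "\<pi> \<in> mset ` {xs. set xs \<subseteq> {..n} \<and> length xs \<le> n}"
      using xs by (auto intro!: image_eqI[of _ _ xs])
  qed
  then show ?thesis
    by (rule finite_subset) (intro finite_imageI finite_lists_length_le, simp)
qed

lemma mex_empty: "mex {#} = 1"
  unfolding mex_def by (rule Least_equality) auto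

text \<open>The next two lemmas show that the natural-number divisions \<open>(p * i - 1) div 12\<close> and
  \<open>(12 * \<delta> + i - p) div (12 * p)\<close> are exact, and that the subtractions do not truncate.\<close>

lemma offset_exact:
  fixes p i :: nat
  assumes "i \<in> {5, 7, 11}" "[p = i] (mod 12)"
  shows "1 \<le> p * i" "12 dvd p * i - 1"
proof -
  obtain a where p: "p = 12 * a + i"
  proof
    have "p mod 12 = i" using assms(1,2) by (auto simp: cong_def)
    then show "p = 12 * (p div 12) + i" using mult_div_mod_eq[of 12 p] by simp
  qed
  show "1 \<le> p * i" using assms(1) unfolding p by auto
  have "(12 * a + 5) * 5 - 1 = 12 * (5 * a + 2)" "(12 * a + 7) * 7 - 1 = 12 * (7 * a + 4)"
    "(12 * a + 11) * 11 - 1 = 12 * (11 * a + 10)"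
    by (simp_all add: algebra_simps)
  then show "12 dvd p * i - 1" using assms(1) unfolding p by (metis dvd_triv_left empty_iff insertE)
qed

lemma reduced_offset_exact:
  fixes p i \<delta> :: nat
  assumes "i \<in> {5, 7, 11}" "prime p" "[p = i] (mod 12)" "p dvd 12 * \<delta> + i"
  shows "p \<le> 12 * \<delta> + i" "12 * p dvd 12 * \<delta> + i - p"
proof -
  show le: "p \<le> 12 * \<delta> + i" using assms(1,4) by (intro dvd_imp_le) auto
  have "[12 * \<delta> + i = p] (mod 12)" using assms(3) by (simp add: cong_def)
  then have "12 dvd 12 * \<delta> + i - p" using le by (simp add: cong_altdef_nat)
  moreover have "p dvd 12 * \<delta> + i - p" using assms(4) by (simp add: dvd_diff_nat)
  moreover have "coprime 12 p"
  proof -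
    have "coprime i 12" 
    proof -
      have "coprime (5::nat) 12" "coprime (7::nat) 12" "coprime (11::nat) 12"
        by (simp_all add: coprime_iff_gcd_eq_1 gcd_non_0_nat)
      then show ?thesis using assms(1) by blast
    qed
    then show ?thesis using assms(3)
      by (metis cong_imp_coprime cong_sym coprime_commute)
  qed
  ultimately show "12 * p dvd 12 * \<delta> + i - p" by (simp add: divides_mult)
qed

end

theory Submission
  imports Defs "HOL-Library.Nat_Bijection" "HOL-Library.Discrete_Functions"
    "HOL-Computational_Algebra.Formal_Power_Series"
begin

text \<open>
  Counting, for each \<open>j\<close>, the partitions that contain all of \<open>1, \<dots>, j\<close> gives
  \<open>\<Sum> \<sigma>mex(n) q^n = \<psi>(q) / (q;q)\<close> with \<open>\<psi>(q) = \<Sum> q^(j(j+1)/2)\<close>.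
  Gauss' identity \<open>\<psi>(q) = (q\<^sup>2;q\<^sup>2)\<^sup>2 / (q;q)\<close> and \<open>(q;q)^4 \<equiv> (q\<^sup>2;q\<^sup>2)\<^sup>2 (mod 4)\<close> show that this
  is congruent to \<open>(q;q)\<^sup>2\<close> modulo 4. By Euler's pentagonal number theorem the coefficients of
  \<open>(q;q)\<^sup>2\<close> are, up to a factor 4, sums of \<open>\<chi>(x) \<chi>(y)\<close> over the integer solutions of
  \<open>x\<^sup>2 + y\<^sup>2 = 24n + 2\<close>, where \<open>\<chi>\<close> is the Kronecker symbol \<open>(12/x)\<close>.
  In Gaussian integers, a prime \<open>p \<equiv> 3 (mod 4)\<close> divides every element whose norm is divisible
  by \<open>p\<^sup>2\<close>. If \<open>p \<equiv> 5 (mod 12)\<close>, then \<open>p\<close> splits, and in the inclusion-exclusion over the multiples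
  of the two prime factors of \<open>p\<close> the two main terms cancel, so that only the multiples of \<open>p\<close>
  remain, with a minus sign.
\<close>

section \<open>The generating function of \<open>\<sigma>mex\<close>\<close>

text \<open>Bounding the parts makes the generating function the inverse of a finite product, so no
  limits are needed. The bound is invisible when \<open>n \<le> k\<close>.\<close>

definition bounded_partitions :: "nat \<Rightarrow> nat \<Rightarrow> nat multiset set" where
  "bounded_partitions k n = {\<pi> \<in> partitions_of n. set_mset \<pi> \<subseteq> {..k}}"

lemma finite_bounded_partitions: "finite (bounded_partitions k n)"
  unfolding bounded_partitions_def using finite_partitions_of by auto

lemma partition_part_le: "\<pi> \<in> partitions_of n \<Longrightarrow> x \<in># \<pi> \<Longrightarrow> x \<le> n"
  by (auto simp: partitions_of_def dest!: multi_member_split)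

lemma bounded_partitions_eq: "n \<le> k \<Longrightarrow> bounded_partitions k n = partitions_of n"
  unfolding bounded_partitions_def using partition_part_le by fastforce

lemma bounded_partitions_0: "bounded_partitions 0 n = (if n = 0 then {{#}} else {})"
proof -
  have "\<pi> = {#}" if "0 \<notin># \<pi>" "set_mset \<pi> \<subseteq> {0}" for \<pi> :: "nat multiset"
    using that by (metis multiset_nonemptyE singletonD subsetD)
  then have "bounded_partitions 0 n = {\<pi>. \<pi> = {#} \<and> sum_mset \<pi> = n}"
    by (auto simp: bounded_partitions_def partitions_of_def)
  then show ?thesis by auto
qed

text \<open>A partition either avoids the part \<open>Suc k\<close>, or removing one copy of it
  leaves a partition of \<open>n - Suc k\<close> under the same bound.\<close>

lemma card_bounded_partitions_Suc:
  "card (bounded_partitions (Suc k) n) = card (bounded_partitions k n) +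
     (if n < Suc k then 0 else card (bounded_partitions (Suc k) (n - Suc k)))"
proof -
  define B where "B = {\<pi> \<in> bounded_partitions (Suc k) n. Suc k \<in># \<pi>}"
  have "bounded_partitions (Suc k) n = bounded_partitions k n \<union> B"
    by (auto simp: B_def bounded_partitions_def le_Suc_eq)
  moreover have "bounded_partitions k n \<inter> B = {}"
    by (auto simp: B_def bounded_partitions_def)
  moreover have "finite B" unfolding B_def using finite_bounded_partitions by auto
  ultimately have "card (bounded_partitions (Suc k) n) = card (bounded_partitions k n) + card B"
    by (simp add: card_Un_disjoint finite_bounded_partitions)
  moreover have "card B = (if n < Suc k then 0 else card (bounded_partitions (Suc k) (n - Suc k)))"
  proof (cases "n < Suc k")
    case True
    then have "B = {}" using partition_part_le by (fastforce simp: B_def bounded_partitions_def)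
    then show ?thesis using True by simp
  next
    case False
    have "B = add_mset (Suc k) ` bounded_partitions (Suc k) (n - Suc k)"
    proof (intro equalityI subsetI)
      fix \<pi> assume "\<pi> \<in> B"
      moreover then obtain \<rho> where "\<pi> = add_mset (Suc k) \<rho>"
        by (auto simp: B_def dest: multi_member_split)
      ultimately show "\<pi> \<in> add_mset (Suc k) ` bounded_partitions (Suc k) (n - Suc k)"
        by (auto simp: B_def bounded_partitions_def partitions_of_def)
    qed (use False in \<open>auto simp: B_def bounded_partitions_def partitions_of_def\<close>)
    then show ?thesis using False by (simp add: card_image inj_on_def)
  qed
  ultimately show ?thesis by simp
qed

definition partition_fps :: "nat \<Rightarrow> int fps" where
  "partition_fps k = Abs_fps (\<lambda>n. int (card (bounded_partitions k n)))"

lemma partition_fps_Suc: "(1 - fps_X ^ Suc k) * partition_fps (Suc k) = partition_fps k"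
  by (rule fps_ext)
    (simp add: partition_fps_def left_diff_distrib fps_X_power_mult_nth card_bounded_partitions_Suc[of k]
          del: power_Suc)

lemma prod_mult_partition_fps: "(\<Prod>j=1..k. 1 - fps_X ^ j) * partition_fps k = 1"
proof (induction k)
  case 0
  show ?case by (rule fps_ext) (simp add: partition_fps_def bounded_partitions_0)
next
  case (Suc k)
  then show ?case using partition_fps_Suc[of k] by (simp add: mult.assoc del: power_Suc)
qed

section \<open>The mex as a count of initial intervals\<close>

lemma mex_conv_card: "mex \<pi> = card {j. {1..j} \<subseteq> set_mset \<pi>}"
proof -
  have "\<exists>m. 0 < m \<and> m \<notin># \<pi>"
  proof -
    obtain m where "m \<notin> insert 0 (set_mset \<pi>)"
      using ex_new_if_finite[of "insert 0 (set_mset \<pi>)"] by auto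
    then show ?thesis by auto
  qed
  then have m: "0 < mex \<pi>" "mex \<pi> \<notin># \<pi>"
    unfolding mex_def by (smt (verit) LeastI_ex)+
  have lt: "j \<in># \<pi>" if "0 < j" "j < mex \<pi>" for j
    using that not_less_Least unfolding mex_def by blast
  \<comment> \<open>The empty interval, \<open>j = 0\<close>, always counts, so the count is the mex
    itself and not one less.\<close>
  have "{j. {1..j} \<subseteq> set_mset \<pi>} = {..<mex \<pi>}"
  proof (intro equalityI subsetI)
    fix j assume "j \<in> {j. {1..j} \<subseteq> set_mset \<pi>}"
    then have "mex \<pi> \<notin> {1..j}" using m by blast
    then have "\<not> mex \<pi> \<le> j" using m by simp
    then show "j \<in> {..<mex \<pi>}" by simp
  qed (use lt in auto)
  then show ?thesis by simp
qed

lemma sum_mset_interval: "\<Sum>\<^sub># (mset_set {1..j}) = triangle j"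
  by (induction j) (auto simp: atLeastAtMostSuc_conv)

text \<open>Removing one copy of each of 1, ..., j is a bijection onto the partitions of
  \<open>n - triangle j\<close>.\<close>

lemma card_partitions_containing_interval:
  "card {\<pi> \<in> partitions_of n. {1..j} \<subseteq> set_mset \<pi>} =
     (if n < triangle j then 0 else card (partitions_of (n - triangle j)))"
proof -
  let ?I = "mset_set {1..j}"
  have sub: "{1..j} \<subseteq> set_mset \<pi> \<longleftrightarrow> ?I \<subseteq># \<pi>" for \<pi>
    by (auto simp: subseteq_mset_def count_mset_set' subset_iff Suc_le_eq)
  have dec: "\<exists>\<rho>. \<pi> = ?I + \<rho> \<and> 0 \<notin># \<rho> \<and> n = triangle j + \<Sum>\<^sub># \<rho>"
    if "\<pi> \<in> partitions_of n" "{1..j} \<subseteq> set_mset \<pi>" for \<pi>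
  proof -
    have "?I \<subseteq># \<pi>" using sub that by simp
    then obtain \<rho> where "\<pi> = ?I + \<rho>" by (auto simp: mset_subset_eq_exists_conv)
    then show ?thesis using that sum_mset_interval by (auto simp: partitions_of_def)
  qed
  show ?thesis
  proof (cases "n < triangle j")
    case True
    then have "{\<pi> \<in> partitions_of n. {1..j} \<subseteq> set_mset \<pi>} = {}" using dec by fastforce
    then show ?thesis using True by (simp only: card.empty if_True)
  next
    case False
    have "{\<pi> \<in> partitions_of n. {1..j} \<subseteq> set_mset \<pi>} = (+) ?I ` partitions_of (n - triangle j)"
    proof (intro equalityI subsetI)
      fix \<pi> assume "\<pi> \<in> {\<pi> \<in> partitions_of n. {1..j} \<subseteq> set_mset \<pi>}"
      then obtain \<rho> where "\<pi> = ?I + \<rho>" "0 \<notin># \<rho>" "n = triangle j + \<Sum>\<^sub># \<rho>" using dec by blast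
      then show "\<pi> \<in> (+) ?I ` partitions_of (n - triangle j)" by (auto simp: partitions_of_def)
    next
      fix \<pi> assume "\<pi> \<in> (+) ?I ` partitions_of (n - triangle j)"
      then show "\<pi> \<in> {\<pi> \<in> partitions_of n. {1..j} \<subseteq> set_mset \<pi>}"
        using False sum_mset_interval by (auto simp: partitions_of_def)
    qed
    then show ?thesis using False by (simp add: card_image)
  qed
qed

text \<open>Double counting of the pairs of a partition and an initial interval inside it. A
  nonempty interval has its endpoint \<open>j\<close> as a part, so \<open>j \<le> n\<close> and any
  cutoff \<open>m \<ge> n\<close> will do.\<close>

lemma sigma_mex_conv_partitions:
  assumes "n \<le> m"
  shows "sigma_mex n = (\<Sum>j\<le>m. if n < triangle j then 0 else card (partitions_of (n - triangle j)))"
proof -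
  have p0: "partitions_of 0 = {{#}}"
    using bounded_partitions_0[of 0] bounded_partitions_eq[of 0 0] by simp
  have "mex \<pi> = (\<Sum>j\<le>m. if {1..j} \<subseteq> set_mset \<pi> then 1 else 0)" if \<pi>: "\<pi> \<in> partitions_of n" for \<pi>
  proof -
    have "j \<le> m" if "{1..j} \<subseteq> set_mset \<pi>" for j
      using that partition_part_le[OF \<pi>, of j] assms by (cases j) (auto simp: subset_iff)
    then have "{j. {1..j} \<subseteq> set_mset \<pi>} = {j \<in> {..m}. {1..j} \<subseteq> set_mset \<pi>}" by auto
    then show ?thesis unfolding mex_conv_card by (simp add: sum.If_cases Int_def)
  qed
  \<comment> \<open>The conventional value 1 at \<open>n = 0\<close> is the mex of the empty
    partition.\<close>
  moreover have "sigma_mex n = (\<Sum>\<pi>\<in>partitions_of n. mex \<pi>)"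
    by (simp add: sigma_mex_def p0 mex_empty)
  ultimately have "sigma_mex n = (\<Sum>\<pi>\<in>partitions_of n. \<Sum>j\<le>m. if {1..j} \<subseteq> set_mset \<pi> then 1 else 0)"
    by simp
  also have "\<dots> = (\<Sum>j\<le>m. \<Sum>\<pi>\<in>partitions_of n. if {1..j} \<subseteq> set_mset \<pi> then 1 else 0)"
    by (rule sum.swap)
  also have "\<dots> = (\<Sum>j\<le>m. card {\<pi> \<in> partitions_of n. {1..j} \<subseteq> set_mset \<pi>})"
    using finite_partitions_of by (simp add: sum.If_cases Int_def)
  finally show ?thesis by (simp only: card_partitions_containing_interval)
qed

lemma sigma_mex_conv_partition_fps:
  assumes "n \<le> m" "n \<le> k"
  shows "int (sigma_mex n) = fps_nth ((\<Sum>j\<le>m. fps_X ^ triangle j) * partition_fps k) n"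
proof -
  have "int (if n < triangle j then 0 else card (partitions_of (n - triangle j))) =
      fps_nth (fps_X ^ triangle j * partition_fps k) n" for j
    using assms by (simp add: fps_X_power_mult_nth partition_fps_def bounded_partitions_eq)
  then show ?thesis
    by (simp only: sigma_mex_conv_partitions[OF assms(1)] of_nat_sum sum_distrib_right fps_sum_nth)
qed

section \<open>Finite forms of the identities of Euler and Gauss\<close>

text \<open>The Kronecker symbol \<open>(12/x)\<close>.\<close>
definition chi12 :: "int \<Rightarrow> int" where
  "chi12 x = (if x mod 12 \<in> {1, 11} then 1 else if x mod 12 \<in> {5, 7} then -1 else 0)"

lemma prod_greaterThanAtMost_Suc_left:
  fixes f :: "nat \<Rightarrow> 'a::comm_monoid_mult"
  assumes "t < n"
  shows "f (Suc t) * (\<Prod>k\<in>{Suc t<..n}. f k) = (\<Prod>k\<in>{t<..n}. f k)"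
proof -
  have "{t<..n} = insert (Suc t) {Suc t<..n}" using assms by auto
  then show ?thesis by simp
qed

lemma prod_greaterThanAtMost_Suc_right:
  fixes f :: "nat \<Rightarrow> 'a::comm_monoid_mult"
  assumes "t \<le> n"
  shows "(\<Prod>k\<in>{t<..Suc n}. f k) = (\<Prod>k\<in>{t<..n}. f k) * f (Suc n)"
proof -
  have "{t<..Suc n} = insert (Suc n) {t<..n}" using assms by auto
  then show ?thesis by (simp add: mult.commute)
qed

lemma chi12_6n:
  "chi12 (int (6 * n + 2)) = 0" "chi12 (int (6 * n + 3)) = 0" "chi12 (int (6 * n + 4)) = 0"
  "chi12 (int (6 * n + 6)) = 0"
  "chi12 (int (6 * n + 5)) = (-1) ^ Suc n" "chi12 (int (6 * n + 7)) = (-1) ^ Suc n"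
proof -
  obtain m where "n = 2 * m \<or> n = 2 * m + 1" by (metis oddE evenE)
  moreover have "(12 * int m + c) mod 12 = c mod 12" for c by simp
  ultimately show
  "chi12 (int (6 * n + 2)) = 0" "chi12 (int (6 * n + 3)) = 0" "chi12 (int (6 * n + 4)) = 0"
  "chi12 (int (6 * n + 6)) = 0"
  "chi12 (int (6 * n + 5)) = (-1) ^ Suc n" "chi12 (int (6 * n + 7)) = (-1) ^ Suc n"
    unfolding chi12_def by (elim disjE; simp; presburger)+
qed

lemma sum_atMost_6_step:
  fixes g :: "nat \<Rightarrow> 'a::comm_monoid_add"
  shows "(\<Sum>x\<le>6 * Suc n + 1. g x) = (\<Sum>x\<le>6 * n + 1. g x) + g (6 * n + 2) + g (6 * n + 3)
     + g (6 * n + 4) + g (6 * n + 5) + g (6 * n + 6) + g (6 * n + 7)"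
proof -
  have "6 * Suc n + 1 = Suc (Suc (Suc (Suc (Suc (Suc (6 * n + 1))))))" by simp
  then show ?thesis by (simp only: sum.atMost_Suc) (simp add: eval_nat_numeral)
qed

text \<open>Shanks' finite form of the pentagonal number theorem: on the left, all terms except \<open>s = 0\<close>
  are divisible by \<open>q^n\<close>; the exponents on the right are the pentagonal numbers for \<open>x = 6j \<plusminus> 1\<close>.\<close>
lemma shanks_pentagonal:
  fixes q :: "'a::comm_ring_1"
  shows "(\<Sum>s\<le>n. (-1) ^ s * (\<Prod>k\<in>{s<..n}. 1 - q ^ k) * q ^ (s * n + triangle s)) =
         (\<Sum>x\<le>6 * n + 1. of_int (chi12 (int x)) * q ^ ((x\<^sup>2 - 1) div 24))"
proof (induction n)
  case 0
  show ?case by (simp add: chi12_def)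
next
  case (Suc n)
  define P where "P s = (\<Prod>k\<in>{s<..n}. 1 - q ^ k)" for s
  \<comment> \<open>\<open>D s\<close> is the change of the \<open>s\<close>-th summand when
    \<open>n\<close> grows by one. The changes telescope as in \<open>tele\<close>, and adding
    \<open>D n\<close> collapses them to one pentagonal term; the other new one is the summand
    \<open>s = Suc n\<close>.\<close>
  define D where "D s = (-1) ^ s * P s * q ^ (s * n + triangle s) * (q ^ s * (1 - q ^ Suc n) - 1)" for s
  have tele: "(\<Sum>s<t. D s) = (-1) ^ t * (1 - q ^ t) * P t * q ^ (t * n + triangle t)" if "t \<le> n" for t
    using that
  proof (induction t)
    case (Suc t)
    have P: "P t = (1 - q ^ Suc t) * P (Suc t)"
      unfolding P_def using prod_greaterThanAtMost_Suc_left[of t n "\<lambda>k. 1 - q ^ k"] Suc.prems by simp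
    have "(\<Sum>s<Suc t. D s) = (-1) ^ t * P t * q ^ (t * n + triangle t) * (1 - q ^ t + (q ^ t * (1 - q ^ Suc n) - 1))"
      using Suc by (simp add: D_def algebra_simps)
    also have "\<dots> = (-1) ^ Suc t * P t * q ^ (Suc t * n + triangle (Suc t))"
      by (simp add: power_add algebra_simps)
    finally show ?case by (simp only: P mult_ac)
  qed simp
  have "(\<Sum>s\<le>Suc n. (-1) ^ s * (\<Prod>k\<in>{s<..Suc n}. 1 - q ^ k) * q ^ (s * Suc n + triangle s)) =
    (\<Sum>s\<le>n. (-1) ^ s * (P s * (1 - q ^ Suc n)) * q ^ (s * Suc n + triangle s)) +
      (-1) ^ Suc n * q ^ (Suc n * Suc n + triangle (Suc n))"
    by (simp add: prod_greaterThanAtMost_Suc_right P_def)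
  also have "(\<Sum>s\<le>n. (-1) ^ s * (P s * (1 - q ^ Suc n)) * q ^ (s * Suc n + triangle s)) =
    (\<Sum>s\<le>n. (-1) ^ s * P s * q ^ (s * n + triangle s)) + (\<Sum>s\<le>n. D s)"
    unfolding sum.distrib[symmetric] by (intro sum.cong refl) (simp add: D_def power_add algebra_simps)
  also have "(\<Sum>s\<le>n. D s) = (\<Sum>s<n. D s) + D n" by (simp add: lessThan_Suc_atMost[symmetric])
  also have "\<dots> = (-1) ^ Suc n * q ^ (Suc n * n + triangle (Suc n))"
    unfolding tele[OF order.refl] by (simp add: D_def P_def power_add algebra_simps)
  finally have step: "(\<Sum>s\<le>Suc n. (-1) ^ s * (\<Prod>k\<in>{s<..Suc n}. 1 - q ^ k) * q ^ (s * Suc n + triangle s)) =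
    (\<Sum>x\<le>6 * n + 1. of_int (chi12 (int x)) * q ^ ((x\<^sup>2 - 1) div 24)) +
     (-1) ^ Suc n * q ^ (Suc n * n + triangle (Suc n)) + (-1) ^ Suc n * q ^ (Suc n * Suc n + triangle (Suc n))"
    using Suc.IH by (simp add: P_def)
  have tri: "2 * triangle (Suc n) = Suc n * (n + 2)" by (simp add: triangle_def)
  \<comment> \<open>The two new terms are those of \<open>x = 6 * n + 5\<close> and
    \<open>x = 6 * n + 7\<close>; the other four new values of \<open>x\<close> have character
    0.\<close>
  then have e: "((6 * n + 5)\<^sup>2 - 1) div 24 = Suc n * n + triangle (Suc n)"
     "((6 * n + 7)\<^sup>2 - 1) div 24 = Suc n * Suc n + triangle (Suc n)"
    by (simp_all add: power2_eq_square algebra_simps)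
  show ?case unfolding step sum_atMost_6_step chi12_6n e by simp
qed

text \<open>Shanks' finite form of Gauss' identity, with denominators cleared.\<close>
lemma shanks_triangular:
  fixes q :: "'a::comm_ring_1"
  shows "(\<Prod>k=1..n. 1 - q ^ (2 * k - 1)) * (\<Sum>s<2 * n. q ^ triangle s) =
    (\<Sum>s<n. (\<Prod>k\<in>{s<..n}. 1 - q ^ (2 * k)) * (\<Prod>k=1..s. 1 - q ^ (2 * k - 1)) * q ^ (s * (2 * n + 1)))"
proof (induction n)
  case 0
  show ?case by simp
next
  case (Suc n)
  define P where "P s = (\<Prod>k\<in>{s<..n}. 1 - q ^ (2 * k))" for s
  define R where "R s = (\<Prod>k=1..s. 1 - q ^ (2 * k - 1))" for s
  \<comment> \<open>The product on the left gains the factor \<open>1 - q ^ (2 * n + 1)\<close>, so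
    \<open>D s\<close> compares the new summand with that multiple of the old one. The differences
    telescope again.\<close>
  define D where "D s = P s * R s * q ^ (s * (2 * n + 1)) * (q ^ (2 * s) * (1 - q ^ (2 * Suc n)) - (1 - q ^ (2 * n + 1)))" for s
  have R: "R (Suc t) = R t * (1 - q ^ (2 * t + 1))" for t by (simp add: R_def)
  have tele: "(\<Sum>s<t. D s) = (1 - q ^ (2 * t)) * P t * R t * q ^ (t * (2 * n + 1))" if "t \<le> n" for t
    using that
  proof (induction t)
    case (Suc t)
    have P: "P t = (1 - q ^ (2 * Suc t)) * P (Suc t)"
      unfolding P_def using prod_greaterThanAtMost_Suc_left[of t n "\<lambda>k. 1 - q ^ (2 * k)"] Suc.prems by simp
    have "(\<Sum>s<Suc t. D s) = P t * R t * q ^ (t * (2 * n + 1)) *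
       (1 - q ^ (2 * t) + (q ^ (2 * t) * (1 - q ^ (2 * Suc n)) - (1 - q ^ (2 * n + 1))))"
      using Suc by (simp add: D_def algebra_simps)
    also have "\<dots> = P t * R (Suc t) * q ^ (Suc t * (2 * n + 1))"
      unfolding R by (simp add: power_add algebra_simps)
    finally show ?case by (simp only: P mult_ac)
  qed simp
  have "s * (2 * Suc n + 1) = s * (2 * n + 1) + 2 * s" for s by simp
  then have ex: "q ^ (s * (2 * Suc n + 1)) = q ^ (s * (2 * n + 1)) * q ^ (2 * s)" for s
    by (simp only: power_add)
  have pw: "q ^ (2 * n + 1) = q * q ^ (2 * n)" "q ^ (2 * Suc n) = q * q * q ^ (2 * n)" by simp_all
  \<comment> \<open>Two regroupings with powers of \<open>q\<close> turned into variables.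
    \<open>gen\<close> splits a new summand into old part and \<open>D s\<close>;
    \<open>gen'\<close>, with \<open>w = q ^ (2 * n)\<close> and
    \<open>u = q ^ (n * (2 * n + 1))\<close>, collects the final terms.\<close>
  have gen': "(1 - q * w) * (r * s) + (1 - w) * r * u + (1 - q * q * w) * r * (u * w) =
    r * (1 - q * w) * (s + u + u * (q * w))" for r s u w by (simp add: algebra_simps)
  have gen: "a * (1 - b) * c * (d * e) = (1 - f) * (a * c * d) + a * c * d * (e * (1 - b) - (1 - f))"
    for a b c d e f :: 'a by (simp add: algebra_simps)
  have tri: "triangle (2 * n) = n * (2 * n + 1)" "triangle (Suc (2 * n)) = n * (2 * n + 1) + (2 * n + 1)"
    by (simp_all add: triangle_def)
  have "(\<Sum>s<Suc n. (\<Prod>k\<in>{s<..Suc n}. 1 - q ^ (2 * k)) * R s * q ^ (s * (2 * Suc n + 1))) =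
    (\<Sum>s<n. P s * (1 - q ^ (2 * Suc n)) * R s * q ^ (s * (2 * Suc n + 1))) +
      (1 - q ^ (2 * Suc n)) * R n * q ^ (n * (2 * Suc n + 1))"
    by (simp add: prod_greaterThanAtMost_Suc_right P_def)
  also have "(\<Sum>s<n. P s * (1 - q ^ (2 * Suc n)) * R s * q ^ (s * (2 * Suc n + 1))) =
    (1 - q ^ (2 * n + 1)) * (\<Sum>s<n. P s * R s * q ^ (s * (2 * n + 1))) + (\<Sum>s<n. D s)"
    unfolding sum.distrib[symmetric] sum_distrib_left ex D_def by (intro sum.cong refl gen)
  also have "(\<Sum>s<n. D s) = (1 - q ^ (2 * n)) * R n * q ^ (n * (2 * n + 1))"
    unfolding tele[OF order.refl] by (simp add: P_def)
  also have "(\<Sum>s<n. P s * R s * q ^ (s * (2 * n + 1))) = R n * (\<Sum>s<2 * n. q ^ triangle s)"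
    using Suc.IH by (simp add: P_def R_def)
  finally have "(\<Sum>s<Suc n. (\<Prod>k\<in>{s<..Suc n}. 1 - q ^ (2 * k)) * R s * q ^ (s * (2 * Suc n + 1))) =
    (1 - q ^ (2 * n + 1)) * (R n * (\<Sum>s<2 * n. q ^ triangle s)) +
    (1 - q ^ (2 * n)) * R n * q ^ (n * (2 * n + 1)) +
    (1 - q ^ (2 * Suc n)) * R n * q ^ (n * (2 * Suc n + 1))" .
  also have "\<dots> = R (Suc n) * ((\<Sum>s<2 * n. q ^ triangle s) + q ^ triangle (2 * n) + q ^ triangle (Suc (2 * n)))"
    unfolding R tri ex power_add[of q "n * (2 * n + 1)"] pw by (rule gen')
  also have "(\<Sum>s<2 * n. q ^ triangle s) + q ^ triangle (2 * n) + q ^ triangle (Suc (2 * n)) = (\<Sum>s<2 * Suc n. q ^ triangle s)"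
    by simp
  finally show ?case unfolding R_def by simp
qed

section \<open>Reduction modulo 4\<close>

text \<open>Congruence modulo the ideal \<open>(4, X^m)\<close>.\<close>
definition fps_cong4 :: "nat \<Rightarrow> int fps \<Rightarrow> int fps \<Rightarrow> bool" where
  "fps_cong4 m f g \<longleftrightarrow> (\<forall>i<m. [fps_nth f i = fps_nth g i] (mod 4))"

lemma fps_cong4_refl [simp]: "fps_cong4 m f f"
  by (simp add: fps_cong4_def)

lemma fps_cong4_sym: "fps_cong4 m f g \<Longrightarrow> fps_cong4 m g f"
  by (simp add: fps_cong4_def cong_sym_eq)

lemma fps_cong4_trans [trans]: "fps_cong4 m f g \<Longrightarrow> fps_cong4 m g h \<Longrightarrow> fps_cong4 m f h"
  unfolding fps_cong4_def by (blast intro: cong_trans)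

lemma fps_cong4_add: "fps_cong4 m f f' \<Longrightarrow> fps_cong4 m g g' \<Longrightarrow> fps_cong4 m (f + g) (f' + g')"
  by (auto simp: fps_cong4_def intro: cong_add)

lemma fps_cong4_mult: "fps_cong4 m f f' \<Longrightarrow> fps_cong4 m g g' \<Longrightarrow> fps_cong4 m (f * g) (f' * g')"
  by (auto simp: fps_cong4_def fps_mult_nth intro!: cong_sum cong_mult)

lemma fps_cong4_power: "fps_cong4 m f g \<Longrightarrow> fps_cong4 m (f ^ k) (g ^ k)"
  by (induction k) (auto intro: fps_cong4_mult)

lemma fps_cong4_prod: "(\<And>k. k \<in> A \<Longrightarrow> fps_cong4 m (f k) (g k)) \<Longrightarrow> fps_cong4 m (prod f A) (prod g A)"
  by (induction A rule: infinite_finite_induct) (auto intro: fps_cong4_mult)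

lemma fps_cong4_sum: "(\<And>k. k \<in> A \<Longrightarrow> fps_cong4 m (f k) (g k)) \<Longrightarrow> fps_cong4 m (sum f A) (sum g A)"
  by (induction A rule: infinite_finite_induct) (auto intro: fps_cong4_add)

lemma fps_cong4_X_power: "m \<le> k \<Longrightarrow> fps_cong4 m (f * fps_X ^ k) 0"
  by (simp add: fps_cong4_def fps_X_power_mult_right_nth)

lemma fps_cong4_prod_extend:
  assumes "m \<le> n"
  shows "fps_cong4 m (\<Prod>k=1..n. 1 - fps_X ^ k) (\<Prod>k=1..m. 1 - fps_X ^ k)"
  using assms
proof (induction n rule: dec_induct)
  case (step n)
  have "fps_cong4 m (1 - fps_X ^ Suc n) 1"
    using step by (auto simp: fps_cong4_def simp del: power_Suc)
  from fps_cong4_mult[OF step.IH this] show ?case by simp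
qed simp

text \<open>\<open>(1 - x)\<^sup>2\<close> and \<open>1 - x\<^sup>2\<close> agree modulo 2, hence
  their squares agree modulo 4; the proof exhibits the quotient.\<close>

lemma one_minus_power4_cong: "fps_cong4 m ((1 - x) ^ 4) ((1 - x\<^sup>2)\<^sup>2)"
proof -
  have "(1 - x) ^ 4 = (1 - x\<^sup>2)\<^sup>2 + 4 * (2 * x\<^sup>2 - x - x ^ 3)"
    by (simp add: eval_nat_numeral algebra_simps)
  also have "\<dots> = (1 - x\<^sup>2)\<^sup>2 + fps_const 4 * (2 * x\<^sup>2 - x - x ^ 3)"
    by (simp add: numeral_fps_const)
  finally show ?thesis
    by (simp add: fps_cong4_def cong_iff_dvd_diff del: fps_const_sub fps_const_add)
qed

lemma prod_power4_cong:
  "fps_cong4 m ((\<Prod>k=1..n. 1 - fps_X ^ k) ^ 4) ((\<Prod>k=1..n. 1 - fps_X ^ (2 * k))\<^sup>2)"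
proof -
  have "fps_cong4 m ((1 - fps_X ^ k) ^ 4) ((1 - fps_X ^ (2 * k))\<^sup>2)" for k
    using one_minus_power4_cong[of m "fps_X ^ k"] by (simp add: power_mult[symmetric] mult.commute)
  then show ?thesis unfolding prod_power_distrib by (intro fps_cong4_prod)
qed

lemma prod_odd_even_split:
  fixes q :: "'a::comm_ring_1"
  shows "(\<Prod>k=1..2 * n. 1 - q ^ k) = (\<Prod>k=1..n. 1 - q ^ (2 * k - 1)) * (\<Prod>k=1..n. 1 - q ^ (2 * k))"
  by (induction n) (simp_all add: mult_ac)

text \<open>In \<open>shanks_triangular\<close>, every summand with \<open>s > 0\<close> has the
  factor \<open>fps_X ^ (s * (2 * m + 1))\<close> and vanishes to the given precision.\<close>

lemma triangular_series_cong:
  "fps_cong4 m ((\<Prod>k=1..m. 1 - fps_X ^ (2 * k - 1)) * (\<Sum>s<2 * m. fps_X ^ triangle s))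
     (\<Prod>k=1..m. 1 - fps_X ^ (2 * k))"
proof (cases m)
  case 0
  then show ?thesis by (simp add: fps_cong4_def)
next
  case (Suc l)
  let ?t = "\<lambda>s. (\<Prod>k\<in>{s<..m}. 1 - fps_X ^ (2 * k)) * (\<Prod>k=1..s. 1 - fps_X ^ (2 * k - 1)) * fps_X ^ (s * (2 * m + 1)) :: int fps"
  have split: "{..<m} = insert 0 {0<..<m}" using Suc by auto
  have "fps_cong4 m (\<Sum>s\<in>{0<..<m}. ?t s) (\<Sum>s\<in>{0<..<m}. 0)"
    by (intro fps_cong4_sum fps_cong4_X_power) (auto simp: Suc_le_eq dest!: gr0_implies_Suc)
  then have "fps_cong4 m (?t 0 + (\<Sum>s\<in>{0<..<m}. ?t s)) (?t 0 + 0)"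
    by (intro fps_cong4_add) auto
  then show ?thesis unfolding shanks_triangular split
    by (simp add: atLeastSucAtMost_greaterThanAtMost)
qed

text \<open>In \<open>shanks_pentagonal\<close>, only the summand \<open>s = 0\<close> survives to
  the given precision.\<close>

lemma pentagonal_series_cong:
  "fps_cong4 m (\<Prod>k=1..m. 1 - fps_X ^ k)
     (\<Sum>x\<le>6 * m + 1. of_int (chi12 (int x)) * fps_X ^ ((x\<^sup>2 - 1) div 24))"
proof -
  let ?t = "\<lambda>s. (-1) ^ s * (\<Prod>k\<in>{s<..m}. 1 - fps_X ^ k) * fps_X ^ (s * m + triangle s) :: int fps"
  have split: "{..m} = insert 0 {0<..m}" by auto
  have "fps_cong4 m (\<Sum>s\<in>{0<..m}. ?t s) (\<Sum>s\<in>{0<..m}. 0)"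
    by (intro fps_cong4_sum fps_cong4_X_power) (auto dest!: gr0_implies_Suc)
  then have "fps_cong4 m 0 (\<Sum>s\<in>{0<..m}. ?t s)" by (simp add: fps_cong4_sym)
  then have "fps_cong4 m (?t 0 + 0) (?t 0 + (\<Sum>s\<in>{0<..m}. ?t s))"
    by (intro fps_cong4_add) auto
  then show ?thesis unfolding shanks_pentagonal[symmetric] split
    by (simp add: atLeastSucAtMost_greaterThanAtMost)
qed

text \<open>In the notation of the proof, the chain is \<open>T * P = D * T * N * P\<^sup>2\<close>,
  then \<open>N\<^sup>2 * P\<^sup>2\<close> by Gauss, \<open>F ^ 4 * P\<^sup>2\<close> by the
  fourth-power congruence, \<open>F\<^sup>2 * E\<^sup>2 * P\<^sup>2\<close> by truncation, and
  \<open>F\<^sup>2\<close> because \<open>E * P = 1\<close>.\<close>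

lemma sigma_mex_cong_prod_square:
  assumes "n < m"
  shows "[int (sigma_mex n) = fps_nth ((\<Prod>k=1..m. 1 - fps_X ^ k)\<^sup>2) n] (mod 4)"
proof -
  \<comment> \<open>\<open>E\<close> has \<open>2 * m\<close> factors so that it splits into
    \<open>m\<close> odd and \<open>m\<close> even ones; it agrees with \<open>F\<close> below
    degree \<open>m\<close>.\<close>
  define E F :: "int fps" where "E = (\<Prod>k=1..2 * m. 1 - fps_X ^ k)" and "F = (\<Prod>k=1..m. 1 - fps_X ^ k)"
  define D N :: "int fps" where "D = (\<Prod>k=1..m. 1 - fps_X ^ (2 * k - 1))" and "N = (\<Prod>k=1..m. 1 - fps_X ^ (2 * k))"
  define T :: "int fps" where "T = (\<Sum>s<2 * m. fps_X ^ triangle s)"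
  define P where "P = partition_fps (2 * m)"
  have EP: "E * P = 1" unfolding E_def P_def by (rule prod_mult_partition_fps)
  have EDN: "E = D * N" unfolding E_def D_def N_def by (rule prod_odd_even_split)
  have EF: "fps_cong4 m E F" unfolding E_def F_def by (intro fps_cong4_prod_extend) simp
  have "T * P = (D * T) * N * P\<^sup>2"
  proof -
    have "T * P = (E * P) * (T * P)" by (simp add: EP)
    then show ?thesis by (simp add: EDN power2_eq_square mult_ac)
  qed
  also have "fps_cong4 m \<dots> (N * N * P\<^sup>2)"
    unfolding D_def N_def T_def by (intro fps_cong4_mult triangular_series_cong fps_cong4_refl)
  also have "N * N * P\<^sup>2 = N\<^sup>2 * P\<^sup>2" by (simp add: power2_eq_square)
  also have "fps_cong4 m \<dots> (F ^ 4 * P\<^sup>2)"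
    unfolding F_def N_def by (intro fps_cong4_mult fps_cong4_sym[OF prod_power4_cong] fps_cong4_refl)
  also have "fps_cong4 m \<dots> (F\<^sup>2 * E\<^sup>2 * P\<^sup>2)"
  proof -
    have "F ^ 4 = F\<^sup>2 * F\<^sup>2" by (simp add: power_add[symmetric])
    then show ?thesis
      by (simp only:) (intro fps_cong4_mult fps_cong4_power fps_cong4_refl fps_cong4_sym[OF EF])
  qed
  also have "F\<^sup>2 * E\<^sup>2 * P\<^sup>2 = F\<^sup>2"
    using EP by (simp add: mult.assoc power_mult_distrib[symmetric])
  finally have "[fps_nth (T * P) n = fps_nth (F\<^sup>2) n] (mod 4)"
    using assms by (simp add: fps_cong4_def)
  moreover have "{..<2 * m} = {..2 * m - 1}" using assms by auto
  then have "int (sigma_mex n) = fps_nth (T * P) n"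
    unfolding T_def P_def using assms
    by (simp only:) (intro sigma_mex_conv_partition_fps, auto)
  ultimately show ?thesis by (simp add: F_def)
qed

text \<open>A nonzero character means that \<open>x\<close> is prime to 6, so its square is 1 modulo
  24. Thus the division in the pentagonal exponents is exact wherever it matters.\<close>

lemma chi12_nonzero_square:
  assumes "chi12 (int x) \<noteq> 0"
  shows "x\<^sup>2 = 24 * ((x\<^sup>2 - 1) div 24) + 1"
proof -
  have "int x mod 12 = 1 \<or> int x mod 12 = 5 \<or> int x mod 12 = 7 \<or> int x mod 12 = 11"
    using assms by (auto simp: chi12_def split: if_splits)
  moreover define d r where "d = x div 12" and "r = x mod 12"
  moreover have "int x mod 12 = int r" by (simp add: r_def zmod_int)
  ultimately have x: "x = 12 * d + r" and r: "r \<in> {1, 5, 7, 11}" by auto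
  have *: "x\<^sup>2 = 24 * (6 * d\<^sup>2 + d * r) + r\<^sup>2" 
    unfolding x by (simp add: power2_eq_square algebra_simps)
  have "r\<^sup>2 mod 24 = 1" using r by auto
  then have "x\<^sup>2 mod 24 = 1" unfolding * by (simp only: mod_mult_self4)
  then have "x\<^sup>2 = 24 * (x\<^sup>2 div 24) + 1" using mult_div_mod_eq[of 24 "x\<^sup>2"] by linarith
  moreover from this have "(x\<^sup>2 - 1) div 24 = x\<^sup>2 div 24"
    by (metis add_diff_cancel_right' nonzero_mult_div_cancel_left zero_neq_numeral)
  ultimately show ?thesis by simp
qed

lemma sigma_mex_cong_two_squares:
  "[int (sigma_mex n) = (\<Sum>(x, y) | x\<^sup>2 + y\<^sup>2 = 24 * n + 2. chi12 (int x) * chi12 (int y))] (mod 4)"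
proof -
  \<comment> \<open>The cutoff of \<open>pentagonal_series_cong\<close> at \<open>m = Suc n\<close>.
    Its square exceeds \<open>24 * n + 2\<close>, so no solution is lost.\<close>
  define B where "B = 6 * Suc n + 1"
  define e where "e x = (x\<^sup>2 - 1) div 24" for x :: nat
  define T :: "int fps" where "T = (\<Sum>x\<le>B. of_int (chi12 (int x)) * fps_X ^ e x)"
  have "fps_cong4 (Suc n) ((\<Prod>k=1..Suc n. 1 - fps_X ^ k)\<^sup>2) (T\<^sup>2)"
    unfolding T_def B_def e_def by (intro fps_cong4_power pentagonal_series_cong)
  then have "[fps_nth ((\<Prod>k=1..Suc n. 1 - fps_X ^ k)\<^sup>2) n = fps_nth (T\<^sup>2) n] (mod 4)"
    unfolding fps_cong4_def by blast
  with sigma_mex_cong_prod_square[of n "Suc n"] have "[int (sigma_mex n) = fps_nth (T\<^sup>2) n] (mod 4)"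
    using cong_trans by blast
  also have "fps_nth (T\<^sup>2) n = (\<Sum>(x, y)\<in>{..B} \<times> {..B}. if e x + e y = n then chi12 (int x) * chi12 (int y) else 0)"
  proof -
    have "T\<^sup>2 = (\<Sum>(x, y)\<in>{..B} \<times> {..B}. fps_const (chi12 (int x) * chi12 (int y)) * fps_X ^ (e x + e y))"
      unfolding T_def power2_eq_square sum_product sum.cartesian_product
      by (intro sum.cong refl) (auto simp: power_add fps_of_int[symmetric])
    then show ?thesis by (simp add: fps_sum_nth case_prod_unfold eq_commute if_distrib cong: if_cong)
  qed
  also have "\<dots> = (\<Sum>(x, y) | x\<^sup>2 + y\<^sup>2 = 24 * n + 2. chi12 (int x) * chi12 (int y))"
  proof -
    have le: "x \<le> B" if "x\<^sup>2 \<le> 24 * n + 2" for x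
    proof (rule ccontr)
      assume "\<not> x \<le> B"
      then have "B\<^sup>2 \<le> x\<^sup>2" by (intro power_mono) auto
      with that show False by (simp add: B_def power2_eq_square algebra_simps)
    qed
    have iff: "e x + e y = n \<longleftrightarrow> x\<^sup>2 + y\<^sup>2 = 24 * n + 2" if "chi12 (int x) \<noteq> 0" "chi12 (int y) \<noteq> 0" for x y
      using chi12_nonzero_square[OF that(1)] chi12_nonzero_square[OF that(2)] unfolding e_def by linarith
    have "(\<Sum>(x, y)\<in>{..B} \<times> {..B}. if e x + e y = n then chi12 (int x) * chi12 (int y) else 0) =
      (\<Sum>(x, y)\<in>{..B} \<times> {..B}. if x\<^sup>2 + y\<^sup>2 = 24 * n + 2 then chi12 (int x) * chi12 (int y) else 0)"
    proof (intro sum.cong refl, clarify)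
      fix x y
      show "(if e x + e y = n then chi12 (int x) * chi12 (int y) else 0) =
        (if x\<^sup>2 + y\<^sup>2 = 24 * n + 2 then chi12 (int x) * chi12 (int y) else 0)"
        using iff[of x y] by (cases "chi12 (int x) = 0 \<or> chi12 (int y) = 0") auto
    qed
    also have "\<dots> = (\<Sum>(x, y) | x\<^sup>2 + y\<^sup>2 = 24 * n + 2. chi12 (int x) * chi12 (int y))"
      by (rule sum.mono_neutral_cong_right) (auto intro!: le split: if_splits)
    finally show ?thesis .
  qed
  finally show ?thesis .
qed

section \<open>Character sums over sums of two squares\<close>

text \<open>These are the Gaussian integers of norm \<open>N\<close>. All signs are kept so that
  multiplication by Gaussian integers maps such sets into each other.\<close>

definition two_squares :: "int \<Rightarrow> (int \<times> int) set" where
  "two_squares N = {(x, y). x\<^sup>2 + y\<^sup>2 = N}"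

definition chi12_sum :: "int \<Rightarrow> int" where
  "chi12_sum N = (\<Sum>(x, y)\<in>two_squares N. chi12 x * chi12 y)"

lemma finite_two_squares: "finite (two_squares N)"
proof -
  have "\<bar>x\<bar> \<le> N" if "x\<^sup>2 + y\<^sup>2 = N" for x y :: int
  proof -
    have "\<bar>x\<bar> \<le> \<bar>x\<bar> * \<bar>x\<bar>" using mult_left_mono[of 1 "\<bar>x\<bar>" "\<bar>x\<bar>"] by (cases "x = 0") simp_all
    also have "\<dots> \<le> N" using that by (simp add: power2_eq_square flip: that)
    finally show ?thesis .
  qed
  from this this[OF trans[OF add.commute]] have "two_squares N \<subseteq> {-N..N} \<times> {-N..N}"
    by (fastforce simp: two_squares_def abs_le_iff)
  then show ?thesis by (rule finite_subset) simp
qed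

lemma chi12_mod: "chi12 (x mod 12) = chi12 x"
  by (simp add: chi12_def)

lemma chi12_cong: "[x = y] (mod 12) \<Longrightarrow> chi12 x = chi12 y"
  by (simp add: chi12_def cong_def)

lemma int_mod_12_cases:
  fixes x :: int
  obtains "x mod 12 = 0" | "x mod 12 = 1" | "x mod 12 = 2" | "x mod 12 = 3" | "x mod 12 = 4"
    | "x mod 12 = 5" | "x mod 12 = 6" | "x mod 12 = 7" | "x mod 12 = 8" | "x mod 12 = 9"
    | "x mod 12 = 10" | "x mod 12 = 11"
proof -
  have "0 \<le> x mod 12" "x mod 12 < 12" by simp_all
  moreover have "m = 0 \<or> m = 1 \<or> m = 2 \<or> m = 3 \<or> m = 4 \<or> m = 5 \<or> m = 6 \<or> m = 7 \<or> m = 8 \<or> m = 9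
    \<or> m = 10 \<or> m = 11" if "0 \<le> m" "m < 12" for m :: int
    using that by presburger
  ultimately show ?thesis using that by blast
qed

lemma chi12_mult: "chi12 (x * y) = chi12 x * chi12 y"
proof -
  have "chi12 (x * y) = chi12 ((x mod 12) * (y mod 12))"
    by (rule chi12_cong) (simp add: cong_def mod_mult_eq)
  also have "\<dots> = chi12 (x mod 12) * chi12 (y mod 12)"
    by (cases x rule: int_mod_12_cases; cases y rule: int_mod_12_cases; simp add: chi12_def)
  finally show ?thesis by (simp only: chi12_mod)
qed

lemma chi12_minus: "chi12 (- x) = chi12 x"
  using chi12_mult[of "-1" x] by (simp add: chi12_def)

text \<open>\<open>chi12\<close> is even and vanishes at 0: each positive solution stands for four
  signed ones, and solutions on the axes contribute nothing.\<close>

lemma chi12_sum_conv_nat: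
  "chi12_sum (int N) = 4 * (\<Sum>(x, y) | x\<^sup>2 + y\<^sup>2 = N. chi12 (int x) * chi12 (int y))"
proof -
  let ?g = "\<lambda>(x, y). chi12 (int x) * chi12 (int y)"
  let ?Q = "{(x, y). x > 0 \<and> y > 0 \<and> x\<^sup>2 + y\<^sup>2 = N}"
  let ?S = "{1, -1} \<times> {1, -1} :: (int \<times> int) set"
  have chi0: "chi12 0 = 0" by (simp add: chi12_def)
  have fin: "finite {(x, y). x\<^sup>2 + y\<^sup>2 = N}"
  proof -
    have "inj_on (\<lambda>(x, y). (int x, int y)) {(x, y). x\<^sup>2 + y\<^sup>2 = N}" by (auto simp: inj_on_def)
    moreover have "(\<lambda>(x, y). (int x, int y)) ` {(x, y). x\<^sup>2 + y\<^sup>2 = N} \<subseteq> two_squares (int N)"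
      by (auto simp: two_squares_def)
    ultimately show ?thesis using finite_two_squares inj_on_finite by blast
  qed
  have Q: "(\<Sum>z | case z of (x, y) \<Rightarrow> x\<^sup>2 + y\<^sup>2 = N. ?g z) = sum ?g ?Q"
    using fin chi0 by (intro sum.mono_neutral_right) (auto intro!: gr0I)
  have "chi12_sum (int N) = (\<Sum>(x, y)\<in>{(x, y)\<in>two_squares (int N). x \<noteq> 0 \<and> y \<noteq> 0}. chi12 x * chi12 y)"
    unfolding chi12_sum_def using finite_two_squares chi0 by (intro sum.mono_neutral_right) auto
  also have "\<dots> = (\<Sum>((s, t), z)\<in>?S \<times> ?Q. ?g z)"
  proof (rule sum.reindex_bij_witness[where
        i = "\<lambda>((s, t), (x, y)). (s * int x, t * int y)" and
        j = "\<lambda>(x, y). ((sgn x, sgn y), (nat \<bar>x\<bar>, nat \<bar>y\<bar>))"], goal_cases)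
    case (1 a)
    then show ?case by (auto simp: sgn_mult_abs)
  next
    case (2 a)
    then obtain x y where xy: "a = (x, y)" "x\<^sup>2 + y\<^sup>2 = int N" "x \<noteq> 0" "y \<noteq> 0"
      by (auto simp: two_squares_def)
    then have "int ((nat \<bar>x\<bar>)\<^sup>2 + (nat \<bar>y\<bar>)\<^sup>2) = int N" by simp
    then have "(nat \<bar>x\<bar>)\<^sup>2 + (nat \<bar>y\<bar>)\<^sup>2 = N" by (simp only: of_nat_eq_iff)
    then show ?case using xy by (simp add: sgn_if)
  next
    case (3 b)
    then show ?case by (auto simp: sgn_mult)
  next
    case (4 b)
    then show ?case by (auto simp: two_squares_def)
  next
    case (5 a)
    then show ?case by (auto simp: abs_if chi12_minus)
  qed
  also have "\<dots> = 4 * sum ?g ?Q"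
  proof -
    have "(\<Sum>((s, t), z)\<in>?S \<times> ?Q. ?g z) = (\<Sum>st\<in>?S. \<Sum>z\<in>?Q. ?g z)"
      by (simp only: sum.cartesian_product) (simp add: case_prod_unfold)
    then show ?thesis by simp
  qed
  finally show ?thesis using Q by simp
qed

text \<open>Scaling both coordinates by \<open>p\<close> multiplies each term by the square of
  \<open>chi12 p\<close>, which is 1.\<close>

lemma chi12_sum_divisible:
  assumes "chi12 p \<noteq> 0"
  shows "(\<Sum>(x, y)\<in>{(x, y)\<in>two_squares (p\<^sup>2 * N). p dvd x \<and> p dvd y}. chi12 x * chi12 y) = chi12_sum N"
proof -
  have p: "p \<noteq> 0" using assms by (auto simp: chi12_def)
  have 1: "chi12 p * chi12 p = 1" using assms by (auto simp: chi12_def split: if_splits)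
  have "chi12_sum N = (\<Sum>(x, y)\<in>two_squares N. chi12 (p * x) * chi12 (p * y))"
    unfolding chi12_sum_def
  proof (intro sum.cong refl, clarify)
    fix x y
    have "chi12 (p * x) * chi12 (p * y) = (chi12 p * chi12 p) * (chi12 x * chi12 y)"
      by (simp only: chi12_mult mult_ac)
    then show "chi12 x * chi12 y = chi12 (p * x) * chi12 (p * y)" using 1 by simp
  qed
  also have "\<dots> = (\<Sum>(x, y)\<in>{(x, y)\<in>two_squares (p\<^sup>2 * N). p dvd x \<and> p dvd y}. chi12 x * chi12 y)"
    by (rule sum.reindex_bij_witness[where i = "\<lambda>(x, y). (x div p, y div p)" and j = "\<lambda>(x, y). (p * x, p * y)"])
      (use p in \<open>auto simp: two_squares_def power_mult_distrib distrib_left[symmetric] elim!: dvdE\<close>)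
  finally show ?thesis by simp
qed

section \<open>Inert primes: \<open>p \<equiv> 3\<close> modulo 4\<close>

lemma prime_3_mod_4_dvd_two_squares:
  fixes p :: nat and x y :: int
  assumes "prime p" "[p = 3] (mod 4)" "int p dvd x\<^sup>2 + y\<^sup>2"
  shows "int p dvd x"
proof (rule ccontr)
  assume x: "\<not> int p dvd x"
  have pi: "prime (int p)" using assms by simp
  have y: "\<not> int p dvd y"
  proof
    assume "int p dvd y"
    then have "int p dvd x\<^sup>2" using assms(3) by (simp add: dvd_add_left_iff power2_eq_square)
    then show False using x pi prime_dvd_power by blast
  qed
  have F: "[z ^ (p - 1) = 1] (mod int p)" if "\<not> int p dvd z" for z :: int
  proof -
    have "[(nat (z mod int p)) ^ (p - 1) = 1] (mod p)"
    proof (rule fermat_theorem[OF assms(1)])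
      have "\<not> int p dvd z mod int p" using that by (simp add: dvd_mod_iff)
      then show "\<not> p dvd nat (z mod int p)"
        using assms(1) prime_gt_0_nat by (metis int_dvd_int_iff nat_0_le of_nat_0_less_iff pos_mod_sign)
    qed
    then have "[int ((nat (z mod int p)) ^ (p - 1)) = int 1] (mod int p)" by (simp only: cong_int_iff)
    moreover have "int (nat (z mod int p)) = z mod int p"
      using assms(1) prime_gt_0_nat by simp
    ultimately show ?thesis by (simp add: cong_def power_mod)
  qed
  have p4: "p mod 4 = 3" using assms(2) by (simp add: cong_def)
  \<comment> \<open>As \<open>h\<close> is odd, raising
    \<open>x\<^sup>2 \<equiv> - (y\<^sup>2)\<close> to the power \<open>h\<close> keeps the sign,
    and Fermat's theorem turns the result into \<open>1 \<equiv> - 1\<close>.\<close>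
  define h where "h = (p - 1) div 2"
  have h: "p - 1 = 2 * h" "odd h" using p4 unfolding h_def by presburger+
  have "[x\<^sup>2 = - (y\<^sup>2)] (mod int p)" using assms(3) by (simp add: cong_iff_dvd_diff)
  then have "[(x\<^sup>2) ^ h = (- (y\<^sup>2)) ^ h] (mod int p)" by (rule cong_pow)
  then have "[x ^ (p - 1) = - (y ^ (p - 1))] (mod int p)"
    using h by (simp add: power_mult)
  with F[OF x] F[OF y] have "[1 = - 1] (mod int p)"
    by (metis cong_minus_minus_iff cong_sym cong_trans)
  then have "int p dvd 2" by (simp add: cong_iff_dvd_diff)
  then have "p \<le> 2" by (metis int_dvd_int_iff nat_dvd_not_less not_le of_nat_numeral zero_less_numeral)
  then show False using p4 by (cases "p = 0") (auto simp: le_Suc_eq numeral_2_eq_2)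
qed

text \<open>Every element of norm \<open>p\<^sup>2 * N\<close> is divisible by \<open>p\<close>, so
  \<open>chi12_sum_divisible\<close> already covers the whole sum.\<close>

lemma chi12_sum_inert:
  assumes "prime p" "[p = 3] (mod 4)" "chi12 (int p) \<noteq> 0"
  shows "chi12_sum ((int p)\<^sup>2 * N) = chi12_sum N"
proof -
  have "int p dvd x \<and> int p dvd y" if "(x, y) \<in> two_squares ((int p)\<^sup>2 * N)" for x y
  proof -
    have "x\<^sup>2 + y\<^sup>2 = (int p)\<^sup>2 * N" using that by (simp add: two_squares_def)
    then have "int p dvd x\<^sup>2 + y\<^sup>2" by (simp add: power2_eq_square)
    then show ?thesis
      using prime_3_mod_4_dvd_two_squares[OF assms(1,2), of x y] prime_3_mod_4_dvd_two_squares[OF assms(1,2), of y x]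
      by (simp add: add.commute)
  qed
  then have "{(x, y)\<in>two_squares ((int p)\<^sup>2 * N). int p dvd x \<and> int p dvd y} = two_squares ((int p)\<^sup>2 * N)" by auto
  then show ?thesis using chi12_sum_divisible[OF assms(3), of N] by (simp add: chi12_sum_def)
qed

section \<open>Split primes: \<open>p \<equiv> 1\<close> modulo 4, then \<open>p \<equiv> 5\<close>
  modulo 12\<close>

lemma prime_1_mod_4_sum_two_squares:
  fixes p :: nat
  assumes "prime p" "[p = 1] (mod 4)"
  obtains a b :: int where "int p = a\<^sup>2 + b\<^sup>2"
proof -
  have p4: "p mod 4 = 1" using assms(2) by (simp add: cong_def)
  have p2: "2 < p" using p4 prime_ge_2_nat[OF assms(1)] by (cases "p = 2") auto
  have "even ((p - 1) div 2)" using p4 by presburger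
  then have L: "[Legendre (- 1) (int p) = 1] (mod int p)"
    using euler_criterion[OF assms(1) p2, of "-1"] by simp
  have "QuadRes (int p) (- 1)"
  proof (rule ccontr)
    assume n: "\<not> QuadRes (int p) (- 1)"
    then have "Legendre (- 1) (int p) \<in> {0, -1}" by (simp add: Legendre_def)
    then have "int p dvd 1 \<or> int p dvd 2" using L by (auto simp: cong_iff_dvd_diff)
    then show False using p2 by (auto dest: zdvd_imp_le)
  qed
  then obtain c where c: "[c\<^sup>2 = - 1] (mod int p)" by (auto simp: QuadRes_def)
  define m where "m = floor_sqrt p"
  have m: "m\<^sup>2 \<le> p" "p < (Suc m)\<^sup>2" unfolding m_def by (simp_all add: Suc_floor_sqrt_power2_gt)
  have "m\<^sup>2 \<noteq> p"
  proof
    assume *: "m\<^sup>2 = p"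
    then have "prime (m\<^sup>2)" using assms by simp
    then show False by (simp add: prime_power_iff)
  qed
  with m have m': "m\<^sup>2 < p" by simp
  \<comment> \<open>Thue's argument: more than \<open>p\<close> pairs share \<open>p\<close>
    residues. The difference \<open>(a, b)\<close> of two colliding pairs satisfies
    \<open>a \<equiv> c * b\<close>, so \<open>p\<close> divides
    \<open>a\<^sup>2 + b\<^sup>2\<close>, which lies strictly between 0 and
    \<open>2 * p\<close>.\<close>
  define f where "f = (\<lambda>(u, v). (int u - c * int v) mod int p)"
  have "f ` ({..m} \<times> {..m}) \<subseteq> {0..<int p}" using p2 by (auto simp: f_def)
  then have "card (f ` ({..m} \<times> {..m})) \<le> card {0..<int p}" by (intro card_mono) auto
  also have "\<dots> < card ({..m} \<times> {..m})" using m(2) by (simp add: power2_eq_square)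
  finally have "\<not> inj_on f ({..m} \<times> {..m})" by (rule pigeonhole)
  then obtain u v u' v' where uv: "u \<le> m" "v \<le> m" "u' \<le> m" "v' \<le> m" "(u, v) \<noteq> (u', v')" "f (u, v) = f (u', v')"
    unfolding inj_on_def by blast
  define a b where "a = int u - int u'" and "b = int v - int v'"
  have "[int u - c * int v = int u' - c * int v'] (mod int p)" using uv by (simp add: f_def cong_def)
  then have "int p dvd a - c * b" by (simp add: cong_iff_dvd_diff a_def b_def algebra_simps)
  then have "int p dvd (a - c * b) * (a + c * b)" by simp
  moreover have "int p dvd (c\<^sup>2 + 1) * b\<^sup>2" using c by (simp add: cong_iff_dvd_diff)
  ultimately have "int p dvd (a - c * b) * (a + c * b) + (c\<^sup>2 + 1) * b\<^sup>2" by (rule dvd_add)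
  also have "(a - c * b) * (a + c * b) + (c\<^sup>2 + 1) * b\<^sup>2 = a\<^sup>2 + b\<^sup>2" by (simp add: power2_eq_square algebra_simps)
  finally obtain t where t: "a\<^sup>2 + b\<^sup>2 = int p * t" by (elim dvdE)
  have "a\<^sup>2 \<le> (int m)\<^sup>2" "b\<^sup>2 \<le> (int m)\<^sup>2"
    unfolding abs_le_square_iff[symmetric] a_def b_def using uv by auto
  moreover have "(int m)\<^sup>2 < int p" using m' by (metis of_nat_less_iff of_nat_power)
  ultimately have lt: "int p * t < int p * 2" unfolding t[symmetric] by linarith
  have "a \<noteq> 0 \<or> b \<noteq> 0" using uv by (auto simp: a_def b_def)
  then have "0 < int p * t" unfolding t[symmetric] by (simp add: sum_power2_gt_zero_iff)
  with lt p2 have "t = 1" by (simp add: zero_less_mult_iff)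
  then show ?thesis using that[of a b] t by simp
qed

text \<open>With \<open>w = x + iy\<close> and \<open>\<pi> = a + ib\<close>, the two terms belong to \<open>\<pi>w\<close> and to its counterpart with
  \<open>\<pi>\<close> conjugated.\<close>
lemma chi12_conjugate_cancel:
  fixes a b x y :: int
  assumes "(a\<^sup>2 + b\<^sup>2) mod 12 = 5" "(x\<^sup>2 + y\<^sup>2) mod 12 = 10"
  shows "chi12 (a * x - b * y) * chi12 (a * y + b * x) + chi12 (a * x + b * y) * chi12 (a * y - b * x) = 0"
proof -
  define A B X Y where d: "A = a mod 12" "B = b mod 12" "X = x mod 12" "Y = y mod 12"
  have sq: "(u\<^sup>2 + v\<^sup>2) mod 12 = ((u mod 12)\<^sup>2 + (v mod 12)\<^sup>2) mod 12" for u v :: int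
  proof -
    have "[u\<^sup>2 + v\<^sup>2 = (u mod 12)\<^sup>2 + (v mod 12)\<^sup>2] (mod 12)"
      by (intro cong_add cong_pow) (simp_all add: cong_def)
    then show ?thesis by (simp add: cong_def)
  qed
  \<comment> \<open>Squares modulo 12 are 0, 1, 4, 9, so 5 arises only as 1 + 4 and, below, 10 only
    as 1 + 9. This leaves few enough residues to check the cancellation case by case.\<close>
  have AB: "(A = 1 \<or> A = 5 \<or> A = 7 \<or> A = 11) \<and> (B = 2 \<or> B = 4 \<or> B = 8 \<or> B = 10) \<or>
        (B = 1 \<or> B = 5 \<or> B = 7 \<or> B = 11) \<and> (A = 2 \<or> A = 4 \<or> A = 8 \<or> A = 10)"
    using assms(1) unfolding sq[of a b] d
    by (cases a rule: int_mod_12_cases; cases b rule: int_mod_12_cases; simp)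
  have XY: "(X = 1 \<or> X = 5 \<or> X = 7 \<or> X = 11) \<and> (Y = 3 \<or> Y = 9) \<or>
        (Y = 1 \<or> Y = 5 \<or> Y = 7 \<or> Y = 11) \<and> (X = 3 \<or> X = 9)"
    using assms(2) unfolding sq[of x y] d
    by (cases x rule: int_mod_12_cases; cases y rule: int_mod_12_cases; simp)
  have red: "[a = A] (mod 12)" "[b = B] (mod 12)" "[x = X] (mod 12)" "[y = Y] (mod 12)"
    by (simp_all add: d cong_def)
  have "chi12 (a * x - b * y) = chi12 (A * X - B * Y)" "chi12 (a * y + b * x) = chi12 (A * Y + B * X)"
    "chi12 (a * x + b * y) = chi12 (A * X + B * Y)" "chi12 (a * y - b * x) = chi12 (A * Y - B * X)"
    by (intro chi12_cong cong_diff cong_add cong_mult red)+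
  moreover have "chi12 (A * X - B * Y) * chi12 (A * Y + B * X) + chi12 (A * X + B * Y) * chi12 (A * Y - B * X) = 0"
    using AB XY by (elim disjE conjE; simp add: chi12_def)
  ultimately show ?thesis by simp
qed

text \<open>The sums over \<open>U\<close> and \<open>V\<close> cancel, so the sum over their union
  is minus the sum over their intersection, the multiples of \<open>p\<close>. The residue of
  \<open>M\<close> gives the cofactors norm 10 modulo 12, as the cancellation requires.\<close>

lemma chi12_sum_split:
  fixes p :: nat
  assumes "prime p" "[p = 5] (mod 12)" "[M = 2] (mod 12)"
  shows "chi12_sum ((int p)\<^sup>2 * M) = - chi12_sum M"
proof -
  have p12: "p mod 12 = 5" using assms(2) by (simp add: cong_def)
  then have "p mod 4 = 1" by presburger
  then obtain a b :: int where ab: "int p = a\<^sup>2 + b\<^sup>2"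
    using prime_1_mod_4_sum_two_squares[OF assms(1)] by (auto simp: cong_def)
  have ip12: "int p mod 12 = 5" using p12 by presburger
  have pi: "prime (int p)" using assms(1) by simp
  have p0: "int p > 0" using assms(1) prime_gt_0_nat by simp
  have ndvd: "\<not> int p dvd a" "\<not> int p dvd b" "\<not> int p dvd 2"
  proof -
    have sq: False if "int p dvd u" "int p = u\<^sup>2 + v\<^sup>2" for u v :: int
    proof -
      have "int p dvd v\<^sup>2" using that dvd_add_right_iff[of "int p" "u\<^sup>2" "v\<^sup>2"]
        by (simp add: power2_eq_square)
      then have "int p dvd v" using pi prime_dvd_power by blast
      then have "(int p)\<^sup>2 dvd u\<^sup>2 + v\<^sup>2" using that(1) by (intro dvd_add dvd_power_same)
      then have "int p * int p dvd int p * 1" using that(2) by (simp add: power2_eq_square)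
      then have "int p dvd 1" using p0 by (subst (asm) dvd_times_left_cancel_iff) auto
      then show False using pi not_prime_unit by blast
    qed
    show "\<not> int p dvd a" "\<not> int p dvd b" using sq ab by (metis add.commute)+
    show "\<not> int p dvd 2" using ip12 p0 by (auto dest!: zdvd_imp_le)
  qed
  define Z where "Z = two_squares ((int p)\<^sup>2 * M)"
  define W where "W = two_squares (int p * M)"
  \<comment> \<open>the elements of \<open>Z\<close> divisible by \<open>a + ib\<close> and by \<open>a - ib\<close>, respectively\<close>
  define U where "U = {(X, Y)\<in>Z. int p dvd a * X + b * Y}"
  define V where "V = {(X, Y)\<in>Z. int p dvd a * X - b * Y}"
  let ?g = "\<lambda>(x, y). chi12 x * chi12 y"
  have norm: "(c * x - d * y)\<^sup>2 + (c * y + d * x)\<^sup>2 = (c\<^sup>2 + d\<^sup>2) * (x\<^sup>2 + y\<^sup>2)" for c d x y :: int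
    by (simp add: power2_eq_square algebra_simps)
  \<comment> \<open>Division by \<open>c + id\<close>: \<open>X + iY = (c + id)(x + iy)\<close>,
    with \<open>x + iy\<close> obtained by multiplying by \<open>c - id\<close> and dividing by
    \<open>p\<close>. It is used for \<open>(a, b)\<close> and \<open>(a, -b)\<close>.\<close>
  have reindex: "sum ?g {(X, Y)\<in>Z. int p dvd c * X + d * Y} = (\<Sum>(x, y)\<in>W. chi12 (c * x - d * y) * chi12 (c * y + d * x))"
    if cd: "int p = c\<^sup>2 + d\<^sup>2" for c d :: int
  proof (rule sum.reindex_bij_witness[where
        j = "\<lambda>(X, Y). ((c * X + d * Y) div int p, (c * Y - d * X) div int p)" and
        i = "\<lambda>(x, y). (c * x - d * y, c * y + d * x)"], goal_cases)
    \<comment> \<open>Divisibility of the real part of \<open>(c - id)(X + iY)\<close> suffices: its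
      norm is divisible by \<open>p\<close>, hence so is the imaginary part.\<close>
    have dvd: "int p dvd c * Y - d * X" if "(X, Y) \<in> Z" "int p dvd c * X + d * Y" for X Y
    proof -
      have "(c * X + d * Y)\<^sup>2 + (c * Y - d * X)\<^sup>2 = int p * (int p)\<^sup>2 * M"
        using norm[of c X "-d" Y] that(1) by (simp add: Z_def two_squares_def cd)
      then have "(c * Y - d * X)\<^sup>2 = int p * (int p)\<^sup>2 * M - (c * X + d * Y)\<^sup>2" by simp
      moreover have "int p dvd \<dots>" using that(2) by (intro dvd_diff) (auto simp: power2_eq_square)
      ultimately show ?thesis using pi prime_dvd_power by metis
    qed
    have rt: "c * x - d * y = X" "c * y + d * x = Y"
      if "c * X + d * Y = int p * x" "c * Y - d * X = int p * y" for x y X Y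
    proof -
      have "int p * (c * x - d * y) = c * (int p * x) - d * (int p * y)" by (simp add: algebra_simps)
      also have "\<dots> = c * (c * X + d * Y) - d * (c * Y - d * X)" by (simp only: that)
      also have "\<dots> = (c\<^sup>2 + d\<^sup>2) * X" by (simp add: power2_eq_square algebra_simps)
      also have "\<dots> = int p * X" by (simp only: cd)
      finally show "c * x - d * y = X" using p0 by simp
      have "int p * (c * y + d * x) = c * (int p * y) + d * (int p * x)" by (simp add: algebra_simps)
      also have "\<dots> = c * (c * Y - d * X) + d * (c * X + d * Y)" by (simp only: that)
      also have "\<dots> = (c\<^sup>2 + d\<^sup>2) * Y" by (simp add: power2_eq_square algebra_simps)
      also have "\<dots> = int p * Y" by (simp only: cd)
      finally show "c * y + d * x = Y" using p0 by simp
    qed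
    {
      case (1 A)
      then obtain X Y where A: "A = (X, Y)" "(X, Y) \<in> Z" "int p dvd c * X + d * Y" by auto
      then obtain x y where xy: "c * X + d * Y = int p * x" "c * Y - d * X = int p * y"
        using dvd by (meson dvdE)
      then show ?case using A rt[OF xy] p0 by simp
    next
      case (2 A)
      then obtain X Y where A: "A = (X, Y)" "(X, Y) \<in> Z" "int p dvd c * X + d * Y" by auto
      then obtain x y where xy: "c * X + d * Y = int p * x" "c * Y - d * X = int p * y"
        using dvd by (meson dvdE)
      have "(int p)\<^sup>2 * (x\<^sup>2 + y\<^sup>2) = (c * X + d * Y)\<^sup>2 + (c * Y - d * X)\<^sup>2"
        unfolding xy by (simp add: power_mult_distrib algebra_simps)
      also have "\<dots> = (int p)\<^sup>2 * (int p * M)"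
        using norm[of c X "-d" Y] A by (simp add: Z_def two_squares_def cd)
      finally have "x\<^sup>2 + y\<^sup>2 = int p * M" using p0 by simp
      then show ?case using A xy p0 by (simp add: W_def two_squares_def)
    next
      case (3 A)
      obtain x y where A: "A = (x, y)" by force
      have "c * (c * x - d * y) + d * (c * y + d * x) = int p * x"
        "c * (c * y + d * x) - d * (c * x - d * y) = int p * y"
        unfolding cd by (simp_all add: power2_eq_square algebra_simps)
      then show ?case using A p0 by simp
    next
      case (4 A)
      then obtain x y where A: "A = (x, y)" "x\<^sup>2 + y\<^sup>2 = int p * M" by (auto simp: W_def two_squares_def)
      have "c * (c * x - d * y) + d * (c * y + d * x) = int p * x"
        unfolding cd by (simp add: power2_eq_square algebra_simps)
      then show ?case using A norm[of c x d y] cd by (simp add: Z_def two_squares_def power2_eq_square)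
    next
      case (5 A)
      then obtain X Y where A: "A = (X, Y)" "(X, Y) \<in> Z" "int p dvd c * X + d * Y" by auto
      then obtain x y where xy: "c * X + d * Y = int p * x" "c * Y - d * X = int p * y"
        using dvd by (meson dvdE)
      then show ?case using A rt[OF xy] p0 by simp
    }
  qed
  have fin: "finite U" "finite V" unfolding U_def V_def Z_def
    by (rule finite_subset[OF _ finite_two_squares]; auto)+
  have UV: "U \<union> V = Z"
  proof -
    have "int p dvd a * X + b * Y \<or> int p dvd a * X - b * Y" if "(X, Y) \<in> Z" for X Y
    proof -
      have "(a * X + b * Y) * (a * X - b * Y) = a\<^sup>2 * (X\<^sup>2 + Y\<^sup>2) - (a\<^sup>2 + b\<^sup>2) * Y\<^sup>2"
        by (simp add: power2_eq_square algebra_simps)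
      also have "\<dots> = int p * (a\<^sup>2 * (int p * M) - Y\<^sup>2)"
        using that ab by (simp add: Z_def two_squares_def power2_eq_square algebra_simps)
      finally show ?thesis using pi by (metis dvd_triv_left prime_dvd_mult_iff)
    qed
    then show ?thesis by (auto simp: U_def V_def)
  qed
  have "U \<inter> V = {(X, Y)\<in>Z. int p dvd X \<and> int p dvd Y}"
  proof -
    have iff: "int p dvd a * X + b * Y \<and> int p dvd a * X - b * Y \<longleftrightarrow> int p dvd X \<and> int p dvd Y" for X Y
    proof
      assume *: "int p dvd a * X + b * Y \<and> int p dvd a * X - b * Y"
      \<comment> \<open>Adding and subtracting isolates \<open>X\<close> and \<open>Y\<close>, since
        \<open>p\<close> divides none of 2, \<open>a\<close> and \<open>b\<close>.\<close>
      have "(a * X + b * Y) + (a * X - b * Y) = 2 * (a * X)" "(a * X + b * Y) - (a * X - b * Y) = 2 * (b * Y)"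
        by simp_all
      then have "int p dvd 2 * (a * X)" "int p dvd 2 * (b * Y)"
        using * by (metis dvd_add, metis dvd_diff)
      then show "int p dvd X \<and> int p dvd Y" using ndvd pi by (simp add: prime_dvd_mult_iff)
    qed auto
    have "U \<inter> V = {(X, Y)\<in>Z. int p dvd a * X + b * Y \<and> int p dvd a * X - b * Y}"
      by (auto simp: U_def V_def)
    then show ?thesis by (simp only: iff)
  qed
  moreover have "chi12 (int p) \<noteq> 0" using ip12 by (simp add: chi12_def)
  ultimately have I: "sum ?g (U \<inter> V) = chi12_sum M"
    using chi12_sum_divisible[of "int p" M] by (simp add: Z_def)
  have "(x\<^sup>2 + y\<^sup>2) mod 12 = 10" if "(x, y) \<in> W" for x y
  proof -
    have "(x\<^sup>2 + y\<^sup>2) mod 12 = (int p mod 12) * (M mod 12) mod 12"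
      using that by (simp add: W_def two_squares_def mod_mult_eq)
    then show ?thesis using ip12 assms(3) by (simp add: cong_def)
  qed
  moreover have "(a\<^sup>2 + b\<^sup>2) mod 12 = 5" using ip12 ab by simp
  ultimately have "sum ?g U + sum ?g V = 0"
    using reindex[of a b] reindex[of a "-b"] ab chi12_conjugate_cancel[of a b]
    by (auto simp: U_def V_def sum.distrib[symmetric] intro!: sum.neutral)
  with sum.union_inter[OF fin, of ?g] show ?thesis
    unfolding UV I by (simp add: chi12_sum_def Z_def)
qed

text \<open>Residue 5 is the split case; residues 7 and 11 are both 3 modulo 4 and hence
  inert.\<close>

lemma chi12_sum_mult_prime_square:
  assumes "prime p" "p mod 12 \<in> {5, 7, 11}" "[M = 2] (mod 12)"
  shows "chi12_sum ((int p)\<^sup>2 * M) = mex_sign p * chi12_sum M"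
proof (cases "p mod 12 = 5")
  case True
  then have "[p = 5] (mod 12)" by (simp add: cong_def)
  then show ?thesis using chi12_sum_split[OF assms(1) _ assms(3)] by (simp add: mex_sign_def)
next
  case False
  then have p: "p mod 12 = 7 \<or> p mod 12 = 11" using assms(2) by auto
  then have "p mod 4 = 3" by presburger
  moreover have "chi12 (int p) \<noteq> 0"
  proof -
    have "int p mod 12 = int (p mod 12)" by (simp add: zmod_int)
    then show ?thesis using p by (auto simp: chi12_def)
  qed
  ultimately show ?thesis
    using False chi12_sum_inert[OF assms(1)] by (simp add: mex_sign_def cong_def)
qed

theorem theorem1p2:
  fixes k i p \<delta> n :: nat
  assumes "k > 0"
    and "i \<in> {5, 7, 11}"
    and "prime p"
    and "[p = i] (mod 12)"
    and "p dvd 12 * \<delta> + i"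
  shows "[int (sigma_mex (p ^ (k + 1) * n + p * \<delta> + (p * i - 1) div 12)) =
          mex_sign p * int (sigma_mex (p ^ (k - 1) * n + (12 * \<delta> + i - p) div (12 * p)))] (mod 4)"
proof -
  define c e where "c = (p * i - 1) div 12" and "e = (12 * \<delta> + i - p) div (12 * p)"
  define u v where "u = p ^ (k + 1) * n + p * \<delta> + c" and "v = p ^ (k - 1) * n + e"
  define b where "b m = (\<Sum>(x, y) | x\<^sup>2 + y\<^sup>2 = 24 * m + 2. chi12 (int x) * chi12 (int y))" for m
  have c: "12 * c + 1 = p * i" using offset_exact[OF assms(2,4)] unfolding c_def by simp
  have e: "12 * p * e + p = 12 * \<delta> + i"
    using reduced_offset_exact[OF assms(2,3,4,5)] unfolding e_def by simp
  have pk: "p ^ (k + 1) = p\<^sup>2 * p ^ (k - 1)"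
    using assms(1) by (cases k) (simp_all add: power2_eq_square)
  \<comment> \<open>The aim is \<open>12 * u + 1 = p\<^sup>2 * (12 * v + 1)\<close>; doubled, it
    relates the two norms by the factor \<open>p\<^sup>2\<close>.\<close>
  have "12 * u + 1 = p ^ (k + 1) * (12 * n) + p * (12 * \<delta>) + (12 * c + 1)"
    by (simp add: u_def algebra_simps)
  also have "\<dots> = p ^ (k + 1) * (12 * n) + p * (12 * \<delta> + i)"
    unfolding c by (simp add: algebra_simps)
  also have "\<dots> = p\<^sup>2 * (12 * v + 1)"
    unfolding e[symmetric] pk by (simp add: v_def power2_eq_square algebra_simps)
  finally have "24 * u + 2 = p\<^sup>2 * (24 * v + 2)" by simp
  then have uv: "int (24 * u + 2) = (int p)\<^sup>2 * int (24 * v + 2)"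
    by (metis of_nat_mult of_nat_power)
  have "p mod 12 \<in> {5, 7, 11}" using assms(2,4) by (auto simp: cong_def)
  moreover have "[int (24 * v + 2) = 2] (mod 12)"
    by (simp add: cong_iff_dvd_diff)
  ultimately have "chi12_sum (int (24 * u + 2)) = mex_sign p * chi12_sum (int (24 * v + 2))"
    unfolding uv by (intro chi12_sum_mult_prime_square assms(3))
  \<comment> \<open>The factor 4 cancels in an exact integer equation; congruences enter only in
    passing from \<open>b\<close> to \<open>sigma_mex\<close>.\<close>
  then have "4 * b u = mex_sign p * (4 * b v)" by (simp only: chi12_sum_conv_nat b_def)
  then have "b u = mex_sign p * b v" by simp
  moreover have "[int (sigma_mex m) = b m] (mod 4)" for m
    unfolding b_def by (rule sigma_mex_cong_two_squares)
  ultimately have "[int (sigma_mex u) = mex_sign p * int (sigma_mex v)] (mod 4)"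
    by (metis (no_types) cong_scalar_left cong_sym cong_trans)
  then show ?thesis by (simp only: u_def v_def c_def e_def)
qed

end
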